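(* Let $N\ge 1$ be an integer, $\epsilon=1/N$, $F>0$, and let $\mathcal{E}^a$ be the next-nearest-neighbor embedded atom energy with pair potential $\phi$, electron density $\rho$ and embedding function $G$ (see context). Suppose that $$\phi''_{F}>0,\quad \phi''_{2F}<0,\quad \rho'_{F}\le 0,\quad \rho'_{2F}\le 0,\quad \rho''_{F}\ge 0,\quad \rho''_{2F}\ge 0,\quad G''_{F}\ge 0,$$ and that $$\phi''_{2F}+G''_{F}\left[(\rho'_{F})^2+20(\rho'_{2F})^2+12\rho'_{F}\rho'_{2F}\right]+2G'_{F}\rho''_{2F}\le 0 .$$ Then the uniform deformation $\mathbf{y}_F$ is stable for the atomistic model (that is, $\langle\delta^2\mathcal{E}^a(\mathbf{y}_F)\mathbf{u},\mathbf{u}\rangle>0$ for all $\mathbf{u}\in\mathcal{U}\setminus\{\mathbf{0}\}$) if and only if $$\begin{aligned} &\hat A_F+\tilde A_F-4\sin^2\!\left(\tfrac{\pi}{2N}\right)\left\{\phi''_{2F}+G''_{F}\left[(\rho'_{F})^2+20(\rho'_{2F})^2+12\rho'_{F}\rho'_{2F}\right]+2G'_{F}\rho''_{2F}\right\}\\ &\qquad+4^2\sin^4\!\left(\tfrac{\pi}{2N}\right)G''_{F}\left[8(\rho'_{2F})^2+2\rho'_{F}\rho'_{2F}\right]-4^3\sin^6\!\left(\tfrac{\pi}{2N}\right)G''_{F}(\rho'_{2F})^2>0 . \end{aligned}$$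
   Context: Setting. Let $N\ge1$ be an integer, $\epsilon=1/N$, $F>0$. $\mathcal{U}$ is the space of real sequences $\mathbf{u}=(u_\ell)_{\ell\in\mathbb{Z}}$ with $u_{\ell+2N}=u_\ell$ and $\sum_{\ell=-N+1}^N u_\ell=0$. Put $(\mathbf{y}_F)_\ell=F\epsilon\ell$ and $\mathcal{Y}_F=\{\mathbf{y}_F+\mathbf{u}:\mathbf{u}\in\mathcal{U}\}$. For a sequence $\mathbf{v}$ write $v'_\ell=Dv_\ell=(v_\ell-v_{\ell-1})/\epsilon$. Let $\phi,\rho,G$ be smooth real-valued functions ($\phi,\rho$ on $(0,\infty)$, $G$ on $\mathbb{R}$). The atomistic energy (per period) is defined for $\mathbf{y}\in\mathcal{Y}_F$ with all $y'_\ell>0$ by $$\mathcal{E}^a(\mathbf{y})=\epsilon\sum_{\ell=-N+1}^N\Big\{G(\bar\rho^a_\ell(\mathbf{y}))+\tfrac12[\phi(y'_\ell)+\phi(y'_\ell+y'_{\ell-1})+\phi(y'_{\ell+1})+\phi(y'_{\ell+1}+y'_{\ell+2})]\Big\},$$ $$\bar\rho^a_\ell(\mathbf{y})=\rho(y'_\ell)+\rho(y'_\ell+y'_{\ell-1})+\rho(y'_{\ell+1})+\rho(y'_{\ell+1}+y'_{\ell+2}).$$ For an energy $\mathcal{E}$, the second variation is $\langle\delta^2\mathcal{E}(\mathbf{y})\mathbf{v},\mathbf{w}\rangle=\sum_{\ell,m=-N+1}^N\frac{\partial^2\mathcal{E}}{\partial y_\ell\partial y_m}(\mathbf{y})v_\ell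 w_m=\frac{\partial^2}{\partial s\,\partial t}\mathcal{E}(\mathbf{y}+s\mathbf{v}+t\mathbf{w})\big|_{s=t=0}$ for $\mathbf{v},\mathbf{w}\in\mathcal{U}$. Notation: $\phi''_F=\phi''(F)$, $\phi''_{2F}=\phi''(2F)$, $\rho'_F=\rho'(F)$, $\rho'_{2F}=\rho'(2F)$, $\rho''_F=\rho''(F)$, $\rho''_{2F}=\rho''(2F)$, $G'_F=G'(\bar\rho_F)$, $G''_F=G''(\bar\rho_F)$, where $\bar\rho_F=2\rho(F)+2\rho(2F)$ (the common value of $\bar\rho^a_\ell(\mathbf{y}_F)$). Further $$\tilde A_F=\phi''_F+4\phi''_{2F},\qquad \hat A_F=4G''_F(\rho'_F+2\rho'_{2F})^2+2G'_F(\rho''_F+4\rho''_{2F}).$$ *)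

theory Defs
  imports "HOL-Analysis.Analysis"
begin

text \<open>Infinite differentiability of a real function on an open set. On an open set the iterated
  derivatives depend only on the values of the function on that set.\<close>

definition smooth_real_on :: "(real \<Rightarrow> real) \<Rightarrow> real set \<Rightarrow> bool" where
  "smooth_real_on f S \<longleftrightarrow> (\<forall>n. \<forall>x\<in>S. (deriv ^^ n) f differentiable at x)"

definition eps :: "nat \<Rightarrow> real" where
  "eps N = 1 / real N"

text \<open>Bi-infinite sequences are functions on the integers; one period is
  \<open>{- int N + 1..int N}\<close>.\<close>

definition displacements :: "nat \<Rightarrow> (int \<Rightarrow> real) set" where
  "displacements N = {u. (\<forall>l. u (l + 2 * int N) = u l) \<and> (\<Sum>l = - int N + 1..int N. u l) = 0}"

definition uniform_deformation :: "nat \<Rightarrow> real \<Rightarrow> int \<Rightarrow> real" where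
  "uniform_deformation N F l = F * eps N * of_int l"

definition strain :: "nat \<Rightarrow> (int \<Rightarrow> real) \<Rightarrow> int \<Rightarrow> real" where
  "strain N v l = (v l - v (l - 1)) / eps N"

definition density_a :: "nat \<Rightarrow> (real \<Rightarrow> real) \<Rightarrow> (int \<Rightarrow> real) \<Rightarrow> int \<Rightarrow> real" where
  "density_a N \<rho> y l =
     \<rho> (strain N y l) + \<rho> (strain N y l + strain N y (l - 1))
     + \<rho> (strain N y (l + 1)) + \<rho> (strain N y (l + 1) + strain N y (l + 2))"

text \<open>The energy is meaningful only for deformations \<open>y = uniform_deformation N F + u\<close>, with
  \<open>u \<in> displacements N\<close>, all of whose strains are positive; elsewhere the formula evaluates the
  potentials at possibly irrelevant arguments. For \<open>F > 0\<close> these deformations form a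
  neighbourhood of \<open>uniform_deformation N F\<close> in the affine space through it, so its second
  variation there does not see the other values.\<close>

definition energy_a ::
  "nat \<Rightarrow> (real \<Rightarrow> real) \<Rightarrow> (real \<Rightarrow> real) \<Rightarrow> (real \<Rightarrow> real) \<Rightarrow> (int \<Rightarrow> real) \<Rightarrow> real" where
  "energy_a N \<phi> \<rho> G y = eps N * (\<Sum>l = - int N + 1..int N.
     G (density_a N \<rho> y l)
     + 1 / 2 * (\<phi> (strain N y l) + \<phi> (strain N y l + strain N y (l - 1))
       + \<phi> (strain N y (l + 1)) + \<phi> (strain N y (l + 1) + strain N y (l + 2))))"

text \<open>The mixed derivative of \<open>E (y + s v + t w)\<close> in \<open>s\<close> and \<open>t\<close> at \<open>s = t = 0\<close>.\<close>

definition second_variation ::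
  "((int \<Rightarrow> real) \<Rightarrow> real) \<Rightarrow> (int \<Rightarrow> real) \<Rightarrow> (int \<Rightarrow> real) \<Rightarrow> (int \<Rightarrow> real) \<Rightarrow> real" where
  "second_variation E y v w =
     deriv (\<lambda>s. deriv (\<lambda>t. E (\<lambda>l. y l + s * v l + t * w l)) 0) 0"

definition stable_deformation :: "nat \<Rightarrow> ((int \<Rightarrow> real) \<Rightarrow> real) \<Rightarrow> (int \<Rightarrow> real) \<Rightarrow> bool" where
  "stable_deformation N E y \<longleftrightarrow> (\<forall>u \<in> displacements N - {\<lambda>_. 0}. second_variation E y u u > 0)"

definition rho_bar :: "(real \<Rightarrow> real) \<Rightarrow> real \<Rightarrow> real" where
  "rho_bar \<rho> F = 2 * \<rho> F + 2 * \<rho> (2 * F)"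

definition A_tilde :: "(real \<Rightarrow> real) \<Rightarrow> real \<Rightarrow> real" where
  "A_tilde \<phi> F = deriv (deriv \<phi>) F + 4 * deriv (deriv \<phi>) (2 * F)"

definition A_hat :: "(real \<Rightarrow> real) \<Rightarrow> (real \<Rightarrow> real) \<Rightarrow> real \<Rightarrow> real" where
  "A_hat G \<rho> F =
     4 * deriv (deriv G) (rho_bar \<rho> F) * (deriv \<rho> F + 2 * deriv \<rho> (2 * F))\<^sup>2
     + 2 * deriv G (rho_bar \<rho> F) * (deriv (deriv \<rho>) F + 4 * deriv (deriv \<rho>) (2 * F))"

end

theory Submission
  imports Defs
begin

text \<open>The second variation along \<open>u\<close> is a translation invariant quadratic form in the strain
  \<open>w\<close> of \<open>u\<close>, with coefficients \<open>a = \<rho>'\<^sub>F\<close>, \<open>b = \<rho>'\<^sub>2\<^sub>F\<close>, \<open>g = G''\<^sub>F\<close>, \<open>P = \<phi>''\<^sub>F + 2 G'\<^sub>F \<rho>''\<^sub>F\<close> and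
  \<open>Q = \<phi>''\<^sub>2\<^sub>F + 2 G'\<^sub>F \<rho>''\<^sub>2\<^sub>F\<close>. The discrete Fourier transform of length \<open>2 N\<close> diagonalizes it; its symbol at the
  frequency \<open>\<pi> k / N\<close> is a cubic polynomial in \<open>s = sin\<^sup>2 (\<pi> k / (2 N))\<close>, nondecreasing on
  \<open>[0, 1]\<close> under the sign hypotheses. A strain has mean zero, so \<open>k = 0\<close> does not occur and the
  symbol is least at \<open>k = 1\<close>. This bound is attained by the displacement
  \<open>u\<^sub>l = cos (\<pi> l / N)\<close>.\<close>

section \<open>Differentiating the energy twice at the uniform deformation\<close>

lemma smooth_real_on_DERIV:
  assumes "smooth_real_on f S" "x \<in> S"
  shows "(f has_real_derivative deriv f x) (at x)"
    and "(deriv f has_real_derivative deriv (deriv f) x) (at x)"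
proof -
  have "(deriv ^^ n) f differentiable at x" for n
    using assms by (auto simp: smooth_real_on_def)
  from this[of 0] this[of 1] show "(f has_real_derivative deriv f x) (at x)"
    and "(deriv f has_real_derivative deriv (deriv f) x) (at x)"
    by (simp_all add: DERIV_deriv_iff_real_differentiable)
qed

lemma DERIV_affine_arg:
  fixes f :: "real \<Rightarrow> real"
  assumes "(f has_real_derivative D) (at (c + r * d))"
  shows "((\<lambda>r. f (c + r * d)) has_real_derivative D * d) (at r)"
  by (rule DERIV_chain2[where f = f and g = "\<lambda>r. c + r * d", OF assms])
    (auto intro!: derivative_eq_intros)

text \<open>With equal directions the energy depends on \<open>s + t\<close> only, so the mixed
  derivative is an ordinary second derivative along a line. Since \<open>deriv\<close> is determined
  by the predicate \<open>has_real_derivative\<close>, which is translation invariant, the identity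
  holds for every \<open>E\<close>.\<close>

lemma second_variation_diag:
  "second_variation E y v v = deriv (deriv (\<lambda>r. E (\<lambda>l. y l + r * v l))) 0"
proof -
  have "deriv (\<lambda>t. E (\<lambda>l. y l + s * v l + t * v l)) 0 = deriv (\<lambda>r. E (\<lambda>l. y l + r * v l)) s" for s
  proof -
    have "(\<lambda>t. E (\<lambda>l. y l + s * v l + t * v l)) = (\<lambda>t. E (\<lambda>l. y l + (t + s) * v l))"
      by (simp add: algebra_simps)
    moreover have "((\<lambda>t. E (\<lambda>l. y l + (t + s) * v l)) has_real_derivative D) (at 0) \<longleftrightarrow>
        ((\<lambda>r. E (\<lambda>l. y l + r * v l)) has_real_derivative D) (at s)" for D
      using DERIV_shift[of "\<lambda>r. E (\<lambda>l. y l + r * v l)" D 0 s] by simp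
    ultimately show ?thesis by (simp add: deriv_def)
  qed
  then show ?thesis by (simp add: second_variation_def)
qed

lemma strain_uniform_plus:
  assumes "N \<ge> 1"
  shows "strain N (\<lambda>l. uniform_deformation N F l + r * u l) l = F + r * strain N u l"
  using assms by (simp add: strain_def uniform_deformation_def eps_def field_simps)

text \<open>Chain and product rule along \<open>r\<close>. Every strain of the uniform deformation
  is \<open>F\<close>, so the coefficients do not depend on \<open>l\<close>. The embedding term
  yields \<open>G''\<close> times the square of the first derivative of the density plus
  \<open>G'\<close> times its second derivative. The sum \<open>w (l + 1) + w (l + 2)\<close>
  appears as \<open>p (l + 2)\<close>.\<close>

lemma second_variation_energy_a_uniform:
  fixes N :: nat and F :: real and \<phi> \<rho> G :: "real \<Rightarrow> real" and u :: "int \<Rightarrow> real"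
  assumes N: "N \<ge> 1" and F: "F > 0"
    and \<phi>: "smooth_real_on \<phi> {0<..}" and \<rho>: "smooth_real_on \<rho> {0<..}"
    and G: "smooth_real_on G UNIV"
  defines "w \<equiv> strain N u"
  defines "p \<equiv> \<lambda>l. w l + w (l - 1)"
  shows "second_variation (energy_a N \<phi> \<rho> G) (uniform_deformation N F) u u =
    eps N * (\<Sum>l = - int N + 1..int N.
      deriv (deriv G) (rho_bar \<rho> F)
        * (deriv \<rho> F * (w l + w (l + 1)) + deriv \<rho> (2 * F) * (p l + p (l + 2)))\<^sup>2
      + deriv G (rho_bar \<rho> F)
        * (deriv (deriv \<rho>) F * ((w l)\<^sup>2 + (w (l + 1))\<^sup>2)
           + deriv (deriv \<rho>) (2 * F) * ((p l)\<^sup>2 + (p (l + 2))\<^sup>2))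
      + 1 / 2 * (deriv (deriv \<phi>) F * ((w l)\<^sup>2 + (w (l + 1))\<^sup>2)
           + deriv (deriv \<phi>) (2 * F) * ((p l)\<^sup>2 + (p (l + 2))\<^sup>2)))"
proof -
  let ?I = "{- int N + 1..int N}"
  \<comment> \<open>\<open>A\<close> is the four-term sum common to the density (\<open>f\<close> =
    \<rho>) and the pair energy (\<open>f\<close> = \<phi>); \<open>B (deriv f)\<close> is its
    derivative in \<open>r\<close>.\<close>
  define A where "A f l r = f (F + r * w l) + f (2 * F + r * p l)
    + f (F + r * w (l + 1)) + f (2 * F + r * p (l + 2))" for f :: "real \<Rightarrow> real" and l r
  define B where "B f l r = f (F + r * w l) * w l + f (2 * F + r * p l) * p l
    + f (F + r * w (l + 1)) * w (l + 1) + f (2 * F + r * p (l + 2)) * p (l + 2)"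
    for f :: "real \<Rightarrow> real" and l r
  define e where "e r = energy_a N \<phi> \<rho> G (\<lambda>l. uniform_deformation N F l + r * u l)" for r
  define e' where "e' r = eps N * (\<Sum>l\<in>?I. deriv G (A \<rho> l r) * B (deriv \<rho>) l r
      + 1 / 2 * B (deriv \<phi>) l r)" for r
  have e: "e r = eps N * (\<Sum>l\<in>?I. G (A \<rho> l r) + 1 / 2 * A \<phi> l r)" for r
  proof -
    have s2: "(F + r * w l) + (F + r * w (l - 1)) = 2 * F + r * p l" for l
      by (simp add: p_def algebra_simps)
    have s2': "(F + r * w (l + 1)) + (F + r * w (l + 2)) = 2 * F + r * p (l + 2)" for l
      by (simp add: p_def algebra_simps)
    show ?thesis
      unfolding e_def energy_a_def density_a_def strain_uniform_plus[OF N] A_def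
        w_def[symmetric] s2 s2' ..
  qed
  \<comment> \<open>Smoothness of \<phi> and \<rho> is available on the positive half-line only;
    \<open>pos\<close> keeps all four arguments there.\<close>
  define pos where "pos l r \<longleftrightarrow> F + r * w l > 0 \<and> 2 * F + r * p l > 0
    \<and> F + r * w (l + 1) > 0 \<and> 2 * F + r * p (l + 2) > 0" for l r
  have ev: "\<forall>\<^sub>F r in nhds 0. pos l r" for l
  proof -
    have "\<forall>\<^sub>F r in nhds 0. c + r * d > 0" if "c > 0" for c d :: real
    proof (rule eventually_nhds_in_open[of "{r. 0 < c + r * d}" 0, simplified])
      show "open {r. 0 < c + r * d}" by (intro open_Collect_less continuous_intros)
    qed (fact that)
    then show ?thesis unfolding pos_def using F by (intro eventually_conj) auto
  qed
  have A': "(A f l has_real_derivative B (deriv f) l r) (at r)"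
    if "pos l r" "smooth_real_on f {0<..}" for f l r
    unfolding A_def B_def using that
    by (intro DERIV_add DERIV_affine_arg smooth_real_on_DERIV(1)[OF that(2)])
      (auto simp: pos_def)
  have e': "(e has_real_derivative e' r) (at r)" if "\<forall>l\<in>?I. pos l r" for r
  proof -
    have "((\<lambda>r. G (A \<rho> l r) + 1 / 2 * A \<phi> l r) has_real_derivative
        deriv G (A \<rho> l r) * B (deriv \<rho>) l r + 1 / 2 * B (deriv \<phi>) l r) (at r)" if "l \<in> ?I" for l
      using that \<open>\<forall>l\<in>?I. pos l r\<close>
      by (intro DERIV_add DERIV_cmult DERIV_chain2[OF smooth_real_on_DERIV(1)[OF G]] A' \<phi> \<rho>) auto
    then show ?thesis unfolding e[abs_def] e'_def by (intro DERIV_cmult DERIV_sum)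
  qed
  have "\<forall>\<^sub>F r in nhds 0. \<forall>l\<in>?I. pos l r"
    by (rule eventually_ball_finite) (use ev in auto)
  then have "\<forall>\<^sub>F r in nhds 0. deriv e r = e' r"
    by (rule eventually_mono) (rule DERIV_imp_deriv[OF e'])
  then have ee': "deriv (deriv e) 0 = deriv e' 0"
    by (rule deriv_cong_ev) simp
  have A0: "A \<rho> l 0 = rho_bar \<rho> F" for l by (simp add: A_def rho_bar_def)
  have pos0: "pos l 0" for l using F by (simp add: pos_def)
  have B': "(B (deriv f) l has_real_derivative
      deriv (deriv f) F * ((w l)\<^sup>2 + (w (l + 1))\<^sup>2)
      + deriv (deriv f) (2 * F) * ((p l)\<^sup>2 + (p (l + 2))\<^sup>2)) (at 0)"
    if "smooth_real_on f {0<..}" for f l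
  proof -
    have d: "((\<lambda>r. deriv f (c + r * d) * d) has_real_derivative deriv (deriv f) c * d * d) (at 0)"
      if "c > 0" for c d
      using that smooth_real_on_DERIV(2)[OF \<open>smooth_real_on f {0<..}\<close>, of c]
      by (intro DERIV_cmult_right DERIV_affine_arg) auto
    have "(B (deriv f) l has_real_derivative
      deriv (deriv f) F * w l * w l + deriv (deriv f) (2 * F) * p l * p l
      + deriv (deriv f) F * w (l + 1) * w (l + 1)
      + deriv (deriv f) (2 * F) * p (l + 2) * p (l + 2)) (at 0)"
      unfolding B_def using F by (intro DERIV_add d) auto
    then show ?thesis by (simp add: algebra_simps power2_eq_square)
  qed
  have B0: "B f l 0 = f F * (w l + w (l + 1)) + f (2 * F) * (p l + p (l + 2))" for f l
    by (simp add: B_def algebra_simps)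
  have "((\<lambda>r. deriv G (A \<rho> l r) * B (deriv \<rho>) l r + 1 / 2 * B (deriv \<phi>) l r) has_real_derivative
      deriv (deriv G) (rho_bar \<rho> F)
        * (deriv \<rho> F * (w l + w (l + 1)) + deriv \<rho> (2 * F) * (p l + p (l + 2)))\<^sup>2
      + deriv G (rho_bar \<rho> F)
        * (deriv (deriv \<rho>) F * ((w l)\<^sup>2 + (w (l + 1))\<^sup>2)
           + deriv (deriv \<rho>) (2 * F) * ((p l)\<^sup>2 + (p (l + 2))\<^sup>2))
      + 1 / 2 * (deriv (deriv \<phi>) F * ((w l)\<^sup>2 + (w (l + 1))\<^sup>2)
           + deriv (deriv \<phi>) (2 * F) * ((p l)\<^sup>2 + (p (l + 2))\<^sup>2))) (at 0)" for l
  proof -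
    have "((\<lambda>r. deriv G (A \<rho> l r)) has_real_derivative
        deriv (deriv G) (A \<rho> l 0) * B (deriv \<rho>) l 0) (at 0)"
      by (rule DERIV_chain2[OF smooth_real_on_DERIV(2)[OF G] A'[OF pos0 \<rho>]]) simp
    from DERIV_add[OF DERIV_mult[OF this B'[OF \<rho>]] DERIV_cmult[OF B'[OF \<phi>], of "1/2"]]
    show ?thesis
      by (rule DERIV_cong) (simp add: A0 B0 power2_eq_square)
  qed
  then have "(e' has_real_derivative eps N * (\<Sum>l\<in>?I.
      deriv (deriv G) (rho_bar \<rho> F)
        * (deriv \<rho> F * (w l + w (l + 1)) + deriv \<rho> (2 * F) * (p l + p (l + 2)))\<^sup>2
      + deriv G (rho_bar \<rho> F)
        * (deriv (deriv \<rho>) F * ((w l)\<^sup>2 + (w (l + 1))\<^sup>2)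
           + deriv (deriv \<rho>) (2 * F) * ((p l)\<^sup>2 + (p (l + 2))\<^sup>2))
      + 1 / 2 * (deriv (deriv \<phi>) F * ((w l)\<^sup>2 + (w (l + 1))\<^sup>2)
           + deriv (deriv \<phi>) (2 * F) * ((p l)\<^sup>2 + (p (l + 2))\<^sup>2)))) (at 0)"
    unfolding e'_def[abs_def] by (intro DERIV_cmult DERIV_sum)
  from DERIV_imp_deriv[OF this] show ?thesis
    unfolding second_variation_diag e_def[symmetric] ee' .
qed

section \<open>Sums over a period and the discrete Fourier transform\<close>

text \<open>Moving the window by one drops its first value and adds the value one period later,
  which is the same. Induction in both directions reaches every integer \<open>d\<close>.\<close>

lemma sum_period_shift:
  fixes f :: "int \<Rightarrow> 'a::ab_group_add"
  assumes per: "\<And>l. f (l + 2 * int N) = f l"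
  shows "(\<Sum>l = - int N + 1..int N. f (l + d)) = (\<Sum>l = - int N + 1..int N. f l)"
proof -
  let ?S = "\<lambda>d. \<Sum>l = - int N + 1..int N. f (l + d)"
  have step: "?S (d + 1) = ?S d" for d
  proof (cases "N = 0")
    case False
    have "?S (d + 1) = (\<Sum>l = - int N + 2..int N + 1. f (l + d))"
      by (rule sum.reindex_bij_witness[where i = "\<lambda>l. l - 1" and j = "\<lambda>l. l + 1"])
        (auto simp: algebra_simps)
    also have "{- int N + 2..int N + 1} = insert (int N + 1) {- int N + 2..int N}"
      using False by auto
    also have "(\<Sum>l\<in>\<dots>. f (l + d)) = f (- int N + 1 + d) + (\<Sum>l = - int N + 2..int N. f (l + d))"
      using per[of "- int N + 1 + d"] by (simp add: algebra_simps)
    also have "\<dots> = (\<Sum>l \<in> insert (- int N + 1) {- int N + 2..int N}. f (l + d))" by simp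
    also have "insert (- int N + 1) {- int N + 2..int N} = {- int N + 1..int N}"
      using False by auto
    finally show ?thesis .
  qed simp
  show ?thesis
  proof (induction d rule: int_induct[where k = 0])
    case base show ?case by simp
  next
    case (step1 i) then show ?case using step[of i] by simp
  next
    case (step2 i) then show ?case using step[of "i - 1"] by simp
  qed
qed

text \<open>Unnormalized, with frequency \<open>pi * k / N\<close>; this puts the factor
  \<open>2 * N\<close> into Parseval's identity.\<close>

definition dft :: "nat \<Rightarrow> (int \<Rightarrow> real) \<Rightarrow> nat \<Rightarrow> complex" where
  "dft N w k = (\<Sum>l = - int N + 1..int N. of_real (w l) * cis (- (pi * k / N * of_int l)))"

text \<open>A geometric sum whose ratio is a \<open>2 * N\<close>-th root of unity, equal to 1 only
  if \<open>2 * N\<close> divides \<open>d\<close>. Differences of two indices of one period satisfy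
  the bound on \<open>d\<close>.\<close>

lemma sum_roots_of_unity:
  assumes "N \<ge> 1" "\<bar>d\<bar> < 2 * int N"
  shows "(\<Sum>k<2 * N. cis (pi * real k / real N * of_int d)) = (if d = 0 then of_nat (2 * N) else 0)"
proof (cases "d = 0")
  case False
  let ?z = "cis (pi / real N * of_int d)"
  have "?z \<noteq> 1"
  proof
    assume "?z = 1"
    then have "cos (pi / real N * of_int d) = 1" by (metis cis.simps(1) one_complex.simps(1))
    then obtain n where "pi / real N * of_int d = of_int n * 2 * pi"
      by (auto simp: cos_one_2pi_int)
    then have "real_of_int d = of_int (2 * int N * n)" using assms by (simp add: field_simps)
    then have "d = 2 * int N * n" by linarith
    then have "2 * int N dvd d" by simp
    then show False using assms(2) False zdvd_imp_le[of "2 * int N" "\<bar>d\<bar>"] by auto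
  qed
  moreover have "?z ^ (2 * N) = 1"
  proof -
    have "real (2 * N) * (pi / real N * of_int d) = 2 * pi * of_int d"
      using assms(1) by simp
    then have "?z ^ (2 * N) = cis (2 * pi * of_int d)" unfolding Complex.DeMoivre by (rule arg_cong)
    then show ?thesis by (simp add: cis_multiple_2pi)
  qed
  moreover have "(\<Sum>k<2 * N. cis (pi * real k / real N * of_int d)) = (\<Sum>k<2 * N. ?z ^ k)"
    by (rule sum.cong) (simp_all add: Complex.DeMoivre field_simps)
  ultimately show ?thesis using False by (simp add: geometric_sum)
qed simp

text \<open>Expand each squared modulus into a double sum over \<open>l\<close> and \<open>m\<close>
  and sum over \<open>k\<close> first; orthogonality of the characters leaves the diagonal.\<close>

lemma dft_Parseval:
  assumes "N \<ge> 1"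
  shows "(\<Sum>k<2 * N. (cmod (dft N w k))\<^sup>2) = 2 * real N * (\<Sum>l = - int N + 1..int N. (w l)\<^sup>2)"
proof -
  let ?I = "{- int N + 1..int N}"
  have sq: "of_real ((cmod (dft N w k))\<^sup>2) =
      (\<Sum>l\<in>?I. \<Sum>m\<in>?I. of_real (w l * w m) * cis (pi * k / N * of_int (m - l)))" for k
  proof -
    have "of_real ((cmod (dft N w k))\<^sup>2) = dft N w k * cnj (dft N w k)"
      by (simp only: complex_norm_square[symmetric] of_real_power)
    also have "\<dots> = (\<Sum>l\<in>?I. \<Sum>m\<in>?I. (of_real (w l) * cis (- (pi * k / N * of_int l)))
        * (of_real (w m) * cis (pi * k / N * of_int m)))"
      by (simp add: dft_def sum_product cis_cnj)
    also have "\<dots> = (\<Sum>l\<in>?I. \<Sum>m\<in>?I. of_real (w l * w m) * cis (pi * k / N * of_int (m - l)))"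
    proof (intro sum.cong refl)
      fix l m
      have "cis (pi * k / N * of_int (m - l))
          = cis (- (pi * k / N * of_int l)) * cis (pi * k / N * of_int m)"
        by (simp add: cis_mult algebra_simps diff_divide_distrib)
      then show "(of_real (w l) * cis (- (pi * k / N * of_int l)))
        * (of_real (w m) * cis (pi * k / N * of_int m))
        = of_real (w l * w m) * cis (pi * k / N * of_int (m - l))" by (simp add: algebra_simps)
    qed
    finally show ?thesis .
  qed
  have "complex_of_real (\<Sum>k<2 * N. (cmod (dft N w k))\<^sup>2) =
      (\<Sum>k<2 * N. \<Sum>l\<in>?I. \<Sum>m\<in>?I. of_real (w l * w m) * cis (pi * k / N * of_int (m - l)))"
    by (simp only: of_real_sum sq)
  also have "\<dots> = (\<Sum>l\<in>?I. \<Sum>k<2 * N. \<Sum>m\<in>?I.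
      of_real (w l * w m) * cis (pi * k / N * of_int (m - l)))"
    by (rule sum.swap)
  also have "\<dots> = (\<Sum>l\<in>?I. \<Sum>m\<in>?I. of_real (w l * w m)
      * (\<Sum>k<2 * N. cis (pi * k / N * of_int (m - l))))"
    by (subst sum.swap) (simp only: sum_distrib_left)
  also have "\<dots> = (\<Sum>l\<in>?I. \<Sum>m\<in>?I. if m = l then of_real (w l * w m) * of_nat (2 * N) else 0)"
  proof (intro sum.cong refl)
    fix l m assume "l \<in> ?I" "m \<in> ?I"
    then have "\<bar>m - l\<bar> < 2 * int N" by auto
    from sum_roots_of_unity[OF assms this]
    show "of_real (w l * w m) * (\<Sum>k<2 * N. cis (pi * k / N * of_int (m - l)))
      = (if m = l then of_real (w l * w m) * of_nat (2 * N) else 0)" by simp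
  qed
  also have "\<dots> = of_real (2 * real N * (\<Sum>l\<in>?I. (w l)\<^sup>2))"
    by (simp add: sum.delta power2_eq_square sum_distrib_left algebra_simps)
  finally show ?thesis by (simp only: of_real_eq_iff)
qed

text \<open>For integer \<open>k\<close> the summand is itself periodic, so the window may be
  translated back; what remains is the phase of the shift. This is what diagonalizes the strain
  form.\<close>

lemma dft_shift:
  assumes "N \<ge> 1" and per: "\<And>l. w (l + 2 * int N) = w l"
  shows "dft N (\<lambda>l. w (l + d)) k = cis (pi * k / N * of_int d) * dft N w k"
proof -
  define f where "f l = of_real (w l) * cis (- (pi * k / N * of_int l))" for l
  have "f (l + 2 * int N) = f l" for l
  proof -
    have "- (pi * k / N * of_int (l + 2 * int N)) = - (pi * k / N * of_int l) + 2 * pi * of_int (- int k)"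
      using assms(1) by (simp add: field_simps)
    then have "cis (- (pi * k / N * of_int (l + 2 * int N)))
        = cis (- (pi * k / N * of_int l)) * cis (2 * pi * of_int (- int k))"
      by (simp only: cis_mult)
    then show ?thesis by (simp add: f_def per cis_multiple_2pi del: of_int_minus)
  qed
  from sum_period_shift[of f N d, OF this]
  have *: "(\<Sum>l = - int N + 1..int N. f (l + d)) = dft N w k" by (simp add: dft_def f_def)
  have "of_real (w (l + d)) * cis (- (pi * k / N * of_int l))
      = cis (pi * k / N * of_int d) * f (l + d)" for l
  proof -
    have "cis (- (pi * k / N * of_int l))
        = cis (pi * k / N * of_int d) * cis (- (pi * k / N * of_int (l + d)))"
      by (simp add: cis_mult algebra_simps add_divide_distrib)
    then show ?thesis by (simp add: f_def)
  qed
  then have "dft N (\<lambda>l. w (l + d)) k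
      = (\<Sum>l = - int N + 1..int N. cis (pi * k / N * of_int d) * f (l + d))"
    unfolding dft_def by simp
  then show ?thesis by (simp only: sum_distrib_left[symmetric] *)
qed

lemma dft_add: "dft N (\<lambda>l. v l + w l) k = dft N v k + dft N w k"
  by (simp add: dft_def sum.distrib algebra_simps)

lemma dft_cmult: "dft N (\<lambda>l. c * w l) k = of_real c * dft N w k"
  by (simp add: dft_def sum_distrib_left algebra_simps)

section \<open>The quadratic form in the strain and its symbol\<close>

text \<open>At frequency \<open>x\<close>, with \<open>s = sin(x/2)^2\<close>, the factor
  \<open>4 * (1 - s)\<close> is the squared modulus of \<open>1 + cis x\<close>, and
  \<open>a + 2 * b - 4 * b * s\<close> is \<open>a + 2 * b * cos x\<close>.\<close>

definition dispersion :: "real \<Rightarrow> real \<Rightarrow> real \<Rightarrow> real \<Rightarrow> real \<Rightarrow> real \<Rightarrow> real" where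
  "dispersion a b g P Q s = 4 * g * (1 - s) * (a + 2 * b - 4 * b * s)\<^sup>2 + P + 4 * Q * (1 - s)"

definition strain_form ::
  "nat \<Rightarrow> real \<Rightarrow> real \<Rightarrow> real \<Rightarrow> real \<Rightarrow> real \<Rightarrow> (int \<Rightarrow> real) \<Rightarrow> real" where
  "strain_form N a b g P Q w = (\<Sum>l = - int N + 1..int N.
     g * (a * (w l + w (l + 1)) + b * (w l + w (l - 1) + w (l + 1) + w (l + 2)))\<^sup>2
     + P * (w l)\<^sup>2 + Q * (w l + w (l - 1))\<^sup>2)"

text \<open>The left side of \<open>K\<close>, times -4, is the derivative of the symbol at
  \<open>s = 0\<close>. The difference of two values is \<open>t - s\<close> times the sum of this
  nonnegative number and a remainder, which is nonnegative on \<open>[0, 1]\<close> because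
  \<open>a * b\<close> and \<open>g\<close> are.\<close>

lemma dispersion_mono:
  assumes "a \<le> 0" "b \<le> 0" "g \<ge> 0"
    and K: "Q + g * (a\<^sup>2 + 20 * b\<^sup>2 + 12 * a * b) \<le> 0"
    and st: "0 \<le> s" "s \<le> t" "t \<le> 1"
  shows "dispersion a b g P Q s \<le> dispersion a b g P Q t"
proof -
  have ab: "a * b \<ge> 0" using assms by (simp add: mult_nonpos_nonpos)
  have "s * s \<le> s" "t * t \<le> t" "s * t \<le> s" "s * t \<le> t"
    using st by (auto intro: mult_left_le mult_left_le_one_le)
  then have "s\<^sup>2 + s * t + t\<^sup>2 \<le> 2 * (s + t)" using st by (simp add: power2_eq_square)
  then have "64 * b\<^sup>2 * (s\<^sup>2 + s * t + t\<^sup>2) \<le> 64 * b\<^sup>2 * (2 * (s + t))"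
    by (intro mult_left_mono) auto
  \<comment> \<open>As \<open>64 * 2 = 16 * 8\<close>, the terms in the square of \<open>b\<close>
    cancel in the bound and only \<open>a * b\<close> is left.\<close>
  then have "16 * (8 * b\<^sup>2 + 2 * (a * b)) * (s + t) - 64 * b\<^sup>2 * (s\<^sup>2 + s * t + t\<^sup>2)
      \<ge> 32 * ((a * b) * (s + t))" by (simp add: algebra_simps)
  moreover have "(a * b) * (s + t) \<ge> 0" using ab st by simp
  ultimately have "g * (16 * (8 * b\<^sup>2 + 2 * (a * b)) * (s + t) - 64 * b\<^sup>2 * (s\<^sup>2 + s * t + t\<^sup>2)) \<ge> 0"
    using \<open>g \<ge> 0\<close> by (intro mult_nonneg_nonneg) auto
  then have "(t - s) * (- 4 * (Q + g * (a\<^sup>2 + 20 * b\<^sup>2 + 12 * a * b))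
      + g * (16 * (8 * b\<^sup>2 + 2 * (a * b)) * (s + t) - 64 * b\<^sup>2 * (s\<^sup>2 + s * t + t\<^sup>2))) \<ge> 0"
    using K st by (intro mult_nonneg_nonneg) auto
  moreover have "\<dots> = dispersion a b g P Q t - dispersion a b g P Q s"
    unfolding dispersion_def by algebra
  ultimately show ?thesis by simp
qed

lemma cmod_one_plus_cis: "(cmod (1 + cis x))\<^sup>2 = 4 * (1 - (sin (x / 2))\<^sup>2)"
proof -
  have "(cmod (1 + cis x))\<^sup>2 = 2 + 2 * cos x"
    unfolding cmod_power2 using sin_cos_squared_add[of x]
    by (simp add: power2_eq_square algebra_simps)
  also have "cos x = 1 - 2 * (sin (x / 2))\<^sup>2"
    using cos_double_sin[of "x / 2"] by simp
  finally show ?thesis by simp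
qed

text \<open>Each of the three squares in the form is the square of a combination of shifts of
  \<open>w\<close>. By Parseval and the shift rule it contributes the squared modulus of a
  trigonometric polynomial in \<open>z = cis x\<close>.\<close>

lemma strain_form_eq_dft:
  assumes N: "N \<ge> 1" and per: "\<And>l. w (l + 2 * int N) = w l"
  shows "2 * real N * strain_form N a b g P Q w =
    (\<Sum>k<2 * N. dispersion a b g P Q ((sin (pi * k / (2 * real N)))\<^sup>2) * (cmod (dft N w k))\<^sup>2)"
proof -
  let ?I = "{- int N + 1..int N}"
  define R where "R = (\<lambda>l. a * (w l + w (l + 1)) + b * (w l + w (l - 1) + w (l + 1) + w (l + 2)))"
  define p where "p = (\<lambda>l. w l + w (l - 1))"
  note sh = dft_shift[OF N, of w, OF per]
  have "dispersion a b g P Q ((sin (pi * k / (2 * real N)))\<^sup>2) * (cmod (dft N w k))\<^sup>2 =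
      g * (cmod (dft N R k))\<^sup>2 + P * (cmod (dft N w k))\<^sup>2 + Q * (cmod (dft N p k))\<^sup>2" for k
  proof -
    define x where "x = pi * k / N"
    define s where "s = (sin (x / 2))\<^sup>2"
    define z where "z = cis x"
    have z: "dft N (\<lambda>l. w (l + 1)) k = z * dft N w k"
      "dft N (\<lambda>l. w (l - 1)) k = cnj z * dft N w k"
      "dft N (\<lambda>l. w (l + 2)) k = z * z * dft N w k"
      using sh[of 1 k] sh[of "-1" k] sh[of 2 k]
      by (simp_all add: z_def x_def cis_cnj cis_mult mult_ac)
    have zz: "z * cnj z = 1" by (simp add: z_def cis_cnj cis_mult)
    have zc: "z + cnj z = of_real (2 * (1 - 2 * s))"
      using cos_double_sin[of "x / 2"] by (simp add: z_def s_def complex_eq_iff)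
    have "dft N R k = (of_real a * (1 + z) + of_real b * (1 + cnj z + z + z * z)) * dft N w k"
      unfolding R_def by (simp add: dft_add dft_cmult z algebra_simps)
    \<comment> \<open>The four-term stencil contains the factor \<open>1 + z\<close> because
      \<open>z * cnj z = 1\<close>; the cofactor is real, which makes its squared modulus a plain
      square.\<close>
    also have "of_real a * (1 + z) + of_real b * (1 + cnj z + z + z * z)
        = (1 + z) * (of_real a + of_real b * (z + cnj z))"
      using zz by (simp add: algebra_simps)
    also have "\<dots> = (1 + z) * of_real (a + 2 * b - 4 * b * s)"
      unfolding zc by (simp add: algebra_simps)
    finally have R: "(cmod (dft N R k))\<^sup>2
        = 4 * (1 - s) * (a + 2 * b - 4 * b * s)\<^sup>2 * (cmod (dft N w k))\<^sup>2"
      using cmod_one_plus_cis[of x]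
      by (simp only: norm_mult norm_of_real power_mult_distrib power2_abs s_def z_def)
    have "dft N p k = (1 + cnj z) * dft N w k"
      unfolding p_def by (simp add: dft_add z algebra_simps)
    moreover have "cmod (1 + cnj z) = cmod (1 + z)"
      by (metis complex_cnj_add complex_cnj_one complex_mod_cnj)
    ultimately have p: "(cmod (dft N p k))\<^sup>2 = 4 * (1 - s) * (cmod (dft N w k))\<^sup>2"
      using cmod_one_plus_cis[of x] by (simp only: norm_mult power_mult_distrib s_def z_def)
    have s: "(sin (pi * k / (2 * real N)))\<^sup>2 = s" by (simp add: x_def s_def mult.commute)
    show ?thesis
      unfolding R p dispersion_def s by (simp add: algebra_simps)
  qed
  then have "(\<Sum>k<2 * N. dispersion a b g P Q ((sin (pi * k / (2 * real N)))\<^sup>2) * (cmod (dft N w k))\<^sup>2)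
      = g * (\<Sum>k<2 * N. (cmod (dft N R k))\<^sup>2) + P * (\<Sum>k<2 * N. (cmod (dft N w k))\<^sup>2)
        + Q * (\<Sum>k<2 * N. (cmod (dft N p k))\<^sup>2)"
    by (simp add: sum.distrib sum_distrib_left)
  also have "\<dots> = 2 * real N * (g * (\<Sum>l\<in>?I. (R l)\<^sup>2) + P * (\<Sum>l\<in>?I. (w l)\<^sup>2) + Q * (\<Sum>l\<in>?I. (p l)\<^sup>2))"
    unfolding dft_Parseval[OF N] by (simp add: algebra_simps)
  also have "\<dots> = 2 * real N * strain_form N a b g P Q w"
    by (simp add: strain_form_def R_def p_def sum.distrib sum_distrib_left)
  finally show ?thesis by simp
qed

text \<open>With \<open>t = pi / (2 * N)\<close>, the bound \<open>k + 1 \<le> 2 * N\<close> puts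
  the angle of mode \<open>k\<close> between \<open>t\<close> and \<open>pi - t\<close>. The sine
  increases up to \<open>pi / 2\<close> and is symmetric about it.\<close>

lemma sin_mode_ge:
  assumes "N \<ge> 1" "1 \<le> k" "k < 2 * N"
  shows "sin (pi / (2 * real N)) \<le> sin (pi * real k / (2 * real N))"
proof -
  have lo: "pi / (2 * real N) \<le> pi * real k / (2 * real N)"
    using assms by (simp add: field_simps)
  have "pi * (real k + 1) \<le> pi * (2 * real N)"
    using assms by (intro mult_left_mono) auto
  then have hi: "pi / (2 * real N) \<le> pi - pi * real k / (2 * real N)"
    using assms by (simp add: field_simps)
  have "- (pi / 2) \<le> 0" "0 \<le> pi / (2 * real N)" by simp_all
  then have nn: "- (pi / 2) \<le> pi / (2 * real N)" by linarith
  show ?thesis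
  proof (cases "pi * real k / (2 * real N) \<le> pi / 2")
    case True
    then show ?thesis using lo nn by (intro sin_monotone_2pi_le) auto
  next
    case False
    then have "sin (pi / (2 * real N)) \<le> sin (pi - pi * real k / (2 * real N))"
      using hi nn by (intro sin_monotone_2pi_le) auto
    then show ?thesis by simp
  qed
qed

text \<open>Compare the two sides frequency by frequency: for \<open>k \<ge> 1\<close> the symbol is
  at least its value at \<open>k = 1\<close>. Parseval turns the comparison back into sums over a
  period.\<close>

lemma strain_form_ge:
  assumes N: "N \<ge> 1" and per: "\<And>l. w (l + 2 * int N) = w l"
    and mean: "(\<Sum>l = - int N + 1..int N. w l) = 0"
    and ab: "a \<le> 0" "b \<le> 0" "g \<ge> 0"
    and K: "Q + g * (a\<^sup>2 + 20 * b\<^sup>2 + 12 * a * b) \<le> 0"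
  shows "dispersion a b g P Q ((sin (pi / (2 * real N)))\<^sup>2) * (\<Sum>l = - int N + 1..int N. (w l)\<^sup>2)
    \<le> strain_form N a b g P Q w"
proof -
  let ?h = "dispersion a b g P Q"
  have "?h ((sin (pi / (2 * real N)))\<^sup>2) * (cmod (dft N w k))\<^sup>2
      \<le> ?h ((sin (pi * k / (2 * real N)))\<^sup>2) * (cmod (dft N w k))\<^sup>2" if "k < 2 * N" for k
  proof (cases "k = 0")
    \<comment> \<open>Monotonicity makes the symbol at frequency 0 at most that at
      \<open>k = 1\<close>, the wrong direction; the term is harmless because the zeroth coefficient
      is the sum of \<open>w\<close>.\<close>
    case True
    have "dft N w 0 = of_real (\<Sum>l = - int N + 1..int N. w l)" by (simp add: dft_def)
    then show ?thesis using True by (simp only: mean) simp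
  next
    case False
    have "0 \<le> sin (pi / (2 * real N))"
      using N by (intro sin_ge_zero) (auto simp: field_simps)
    then have "(sin (pi / (2 * real N)))\<^sup>2 \<le> (sin (pi * k / (2 * real N)))\<^sup>2"
      using sin_mode_ge[OF N _ that] False by (intro power_mono) auto
    then have "?h ((sin (pi / (2 * real N)))\<^sup>2) \<le> ?h ((sin (pi * k / (2 * real N)))\<^sup>2)"
      by (intro dispersion_mono[OF ab K]) (auto simp: abs_square_le_1)
    then show ?thesis by (rule mult_right_mono) simp
  qed
  then have "?h ((sin (pi / (2 * real N)))\<^sup>2) * (\<Sum>k<2 * N. (cmod (dft N w k))\<^sup>2)
      \<le> (\<Sum>k<2 * N. ?h ((sin (pi * k / (2 * real N)))\<^sup>2) * (cmod (dft N w k))\<^sup>2)"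
    unfolding sum_distrib_left by (intro sum_mono) auto
  then have "2 * real N * (?h ((sin (pi / (2 * real N)))\<^sup>2) * (\<Sum>l = - int N + 1..int N. (w l)\<^sup>2))
      \<le> 2 * real N * strain_form N a b g P Q w"
    unfolding dft_Parseval[OF N] strain_form_eq_dft[where w = w, OF N per]
    by (simp only: mult.left_commute mult.assoc)
  then show ?thesis using N by simp
qed

text \<open>For an eigenvector of the two-sided neighbour sum with eigenvalue
  \<open>2 * cos x = 2 * (1 - 2 * s)\<close> the form can be evaluated directly: the four-term
  stencil collapses to a multiple of \<open>p (l + 1)\<close>. Used to show that the lower bound is
  attained.\<close>

lemma strain_form_eigen:
  assumes per: "\<And>l. w (l + 2 * int N) = w l"
    and eig: "\<And>l. w (l + 1) + w (l - 1) = 2 * (1 - 2 * s) * w l"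
  shows "strain_form N a b g P Q w = dispersion a b g P Q s * (\<Sum>l = - int N + 1..int N. (w l)\<^sup>2)"
proof -
  let ?S = "\<lambda>f. \<Sum>l = - int N + 1..int N. f l :: real"
  define p where "p l = w l + w (l - 1)" for l
  have perp: "p (l + 2 * int N) = p l" for l
    using per[of l] per[of "l - 1"] by (simp add: p_def algebra_simps)
  have R: "a * (w l + w (l + 1)) + b * (w l + w (l - 1) + w (l + 1) + w (l + 2))
      = (a + 2 * b - 4 * b * s) * p (l + 1)" for l
  proof -
    have "w l + w (l - 1) + w (l + 1) + w (l + 2) = 2 * (1 - 2 * s) * p (l + 1)"
      using eig[of l] eig[of "l + 1"] by (simp add: p_def algebra_simps)
    moreover have "w l + w (l + 1) = p (l + 1)" by (simp add: p_def)
    ultimately show ?thesis by (simp only:) (simp add: algebra_simps)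
  qed
  have p1: "?S (\<lambda>l. (p (l + 1))\<^sup>2) = ?S (\<lambda>l. (p l)\<^sup>2)"
    by (rule sum_period_shift[where f = "\<lambda>l. (p l)\<^sup>2"]) (simp add: perp)
  have w1: "?S (\<lambda>l. (w (l + -1))\<^sup>2) = ?S (\<lambda>l. (w l)\<^sup>2)"
    by (rule sum_period_shift[where f = "\<lambda>l. (w l)\<^sup>2"]) (simp add: per)
  \<comment> \<open>Forward and backward lag-one correlations agree, and \<open>eig\<close>
    determines their sum; hence each is \<open>1 - 2 * s\<close> times the sum of squares.\<close>
  have w2: "?S (\<lambda>l. w (l + 1) * w ((l + 1) - 1)) = ?S (\<lambda>l. w l * w (l - 1))"
  proof (rule sum_period_shift[where f = "\<lambda>l. w l * w (l - 1)"])
    show "w (l + 2 * int N) * w (l + 2 * int N - 1) = w l * w (l - 1)" for l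
      using per[of l] per[of "l - 1"] by (simp add: algebra_simps)
  qed
  have "?S (\<lambda>l. w (l + 1) * w l) + ?S (\<lambda>l. w l * w (l - 1)) = ?S (\<lambda>l. (w (l + 1) + w (l - 1)) * w l)"
    by (simp add: sum.distrib algebra_simps)
  also have "\<dots> = 2 * (1 - 2 * s) * ?S (\<lambda>l. (w l)\<^sup>2)"
    by (simp add: eig sum_distrib_left power2_eq_square mult.assoc)
  finally have cross: "?S (\<lambda>l. w l * w (l - 1)) = (1 - 2 * s) * ?S (\<lambda>l. (w l)\<^sup>2)"
    using w2 by (simp add: algebra_simps)
  have "?S (\<lambda>l. (p l)\<^sup>2) = ?S (\<lambda>l. (w l)\<^sup>2) + ?S (\<lambda>l. (w (l - 1))\<^sup>2) + 2 * ?S (\<lambda>l. w l * w (l - 1))"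
    by (simp add: p_def power2_sum sum.distrib sum_distrib_left algebra_simps)
  also have "\<dots> = 4 * (1 - s) * ?S (\<lambda>l. (w l)\<^sup>2)"
    using w1 cross by (simp add: algebra_simps)
  finally have pp: "?S (\<lambda>l. (p l)\<^sup>2) = 4 * (1 - s) * ?S (\<lambda>l. (w l)\<^sup>2)" .
  have "strain_form N a b g P Q w = g * (a + 2 * b - 4 * b * s)\<^sup>2 * ?S (\<lambda>l. (p (l + 1))\<^sup>2)
      + P * ?S (\<lambda>l. (w l)\<^sup>2) + Q * ?S (\<lambda>l. (p l)\<^sup>2)"
    unfolding strain_form_def R
    by (simp add: p_def sum.distrib sum_distrib_left power_mult_distrib mult.assoc)
  then show ?thesis unfolding p1 pp dispersion_def by (simp add: algebra_simps)
qed

section \<open>Strains of displacements and the extremal mode\<close>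

lemma strain_periodic:
  assumes "\<And>l. u (l + 2 * int N) = u l"
  shows "strain N u (l + 2 * int N) = strain N u l"
  using assms[of l] assms[of "l - 1"] by (simp add: strain_def algebra_simps)

text \<open>Over a period, a square and its shifted copy have the same sum. Merging them cancels the
  factor 1/2 of the pair energy and doubles the \<open>G'\<close> terms, which explains the
  coefficients of the form.\<close>

lemma second_variation_eq_strain_form:
  fixes N :: nat and F :: real and \<phi> \<rho> G :: "real \<Rightarrow> real" and u :: "int \<Rightarrow> real"
  assumes "N \<ge> 1" "F > 0" "smooth_real_on \<phi> {0<..}" "smooth_real_on \<rho> {0<..}"
    "smooth_real_on G UNIV" and per: "\<And>l. u (l + 2 * int N) = u l"
  shows "second_variation (energy_a N \<phi> \<rho> G) (uniform_deformation N F) u u =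
    eps N * strain_form N (deriv \<rho> F) (deriv \<rho> (2 * F)) (deriv (deriv G) (rho_bar \<rho> F))
      (deriv (deriv \<phi>) F + 2 * deriv G (rho_bar \<rho> F) * deriv (deriv \<rho>) F)
      (deriv (deriv \<phi>) (2 * F) + 2 * deriv G (rho_bar \<rho> F) * deriv (deriv \<rho>) (2 * F))
      (strain N u)"
proof -
  let ?S = "\<lambda>f. \<Sum>l = - int N + 1..int N. f l :: real"
  define w where "w = strain N u"
  define p where "p l = w l + w (l - 1)" for l
  have perw: "w (l + 2 * int N) = w l" for l
    unfolding w_def using per by (rule strain_periodic)
  have perp: "p (l + 2 * int N) = p l" for l
    using perw[of l] perw[of "l - 1"] by (simp add: p_def algebra_simps)
  have w1: "?S (\<lambda>l. (w (l + 1))\<^sup>2) = ?S (\<lambda>l. (w l)\<^sup>2)"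
    by (rule sum_period_shift[where f = "\<lambda>l. (w l)\<^sup>2"]) (simp add: perw)
  have p2: "?S (\<lambda>l. (p (l + 2))\<^sup>2) = ?S (\<lambda>l. (p l)\<^sup>2)"
    by (rule sum_period_shift[where f = "\<lambda>l. (p l)\<^sup>2"]) (simp add: perp)
  have sums: "?S (\<lambda>l. g * (R l)\<^sup>2
      + G1 * (r1 * ((w l)\<^sup>2 + (w (l + 1))\<^sup>2) + r2 * ((p l)\<^sup>2 + (p (l + 2))\<^sup>2))
      + 1 / 2 * (f1 * ((w l)\<^sup>2 + (w (l + 1))\<^sup>2) + f2 * ((p l)\<^sup>2 + (p (l + 2))\<^sup>2)))
    = ?S (\<lambda>l. g * (R l)\<^sup>2 + (f1 + 2 * G1 * r1) * (w l)\<^sup>2 + (f2 + 2 * G1 * r2) * (p l)\<^sup>2)"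
    for g G1 r1 r2 f1 f2 and R :: "int \<Rightarrow> real"
    by (simp only: sum.distrib sum_distrib_left[symmetric] w1 p2) (simp add: algebra_simps)
  have pp: "p l + p (l + 2) = w l + w (l - 1) + w (l + 1) + w (l + 2)" for l
    by (simp add: p_def algebra_simps)
  show ?thesis
    unfolding second_variation_energy_a_uniform[OF assms(1-5)] w_def[symmetric] p_def[symmetric]
      sums strain_form_def pp ..
qed

text \<open>The sums of \<open>u l\<close> and \<open>u (l - 1)\<close> over a period agree. This
  excludes frequency 0 for strains.\<close>

lemma displacements_strain_mean:
  assumes "u \<in> displacements N"
  shows "(\<Sum>l = - int N + 1..int N. strain N u l) = 0"
proof -
  have "(\<Sum>l = - int N + 1..int N. u (l + -1)) = (\<Sum>l = - int N + 1..int N. u l)"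
    using assms by (intro sum_period_shift) (auto simp: displacements_def)
  then show ?thesis
    by (simp add: strain_def sum_divide_distrib[symmetric] sum_subtractf)
qed

text \<open>Vanishing strain makes \<open>u\<close> constant, and a constant of mean zero is
  zero.\<close>

lemma displacements_strain_sq_pos:
  assumes N: "N \<ge> 1" and u: "u \<in> displacements N" "u \<noteq> (\<lambda>_. 0)"
  shows "(\<Sum>l = - int N + 1..int N. (strain N u l)\<^sup>2) > 0"
proof (rule ccontr)
  let ?I = "{- int N + 1..int N}"
  assume "\<not> ?thesis"
  then have "(\<Sum>l\<in>?I. (strain N u l)\<^sup>2) = 0"
    by (meson antisym_conv2 not_le sum_nonneg zero_le_power2)
  moreover have "(\<Sum>l\<in>?I. (strain N u (l + d))\<^sup>2) = (\<Sum>l\<in>?I. (strain N u l)\<^sup>2)" for d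
    by (rule sum_period_shift[where f = "\<lambda>l. (strain N u l)\<^sup>2"])
      (use u in \<open>simp add: strain_periodic displacements_def\<close>)
  ultimately have "(\<Sum>l\<in>?I. (strain N u (l + d))\<^sup>2) = 0" for d by simp
  then have "\<forall>l\<in>?I. strain N u (l + d) = 0" for d
    by (subst (asm) sum_nonneg_eq_0_iff) auto
  \<comment> \<open>Any integer index is reached by shifting by \<open>d\<close> and reading off
    \<open>l = 0\<close>, which lies in the period since \<open>N \<ge> 1\<close>.\<close>
  then have "strain N u (0 + d) = 0" for d
    using N by (intro bspec[where A = ?I and P = "\<lambda>l. strain N u (l + d) = 0"]) auto
  then have step: "u d = u (d - 1)" for d
    using N by (simp add: strain_def eps_def)
  have const: "u l = u 0" for l
  proof (induction l rule: int_induct[where k = 0])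
    case (step1 i) then show ?case using step[of "i + 1"] by simp
  next
    case (step2 i) then show ?case using step[of i] by simp
  qed simp
  have "(\<Sum>l\<in>?I. u l) = (\<Sum>l\<in>?I. u 0)" by (rule sum.cong) (use const in auto)
  then have "u 0 = 0" using u N by (simp add: displacements_def)
  then show False using u(2) const by auto
qed

text \<open>This is the mode of frequency \<open>pi / N\<close>; the addition formulas give the
  eigenvalue \<open>2 * cos (pi / N)\<close>.\<close>

lemma cos_displacement:
  assumes N: "N \<ge> 1" and u_def: "u = (\<lambda>l::int. cos (pi / N * of_int l))"
  shows "u \<in> displacements N" "u \<noteq> (\<lambda>_. 0)"
    and "u (l + 1) + u (l - 1) = 2 * (1 - 2 * (sin (pi / (2 * real N)))\<^sup>2) * u l"
proof -
  have eig: "u (l + 1) + u (l - 1) = 2 * cos (pi / N) * u l" for l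
    by (simp add: u_def distrib_left right_diff_distrib add_divide_distrib diff_divide_distrib
      cos_add cos_diff)
  have per: "u (l + 2 * int N) = u l" for l
  proof -
    have "pi / N * of_int (l + 2 * int N) = pi / N * of_int l + 2 * pi"
      using N by (simp add: field_simps)
    then show ?thesis by (simp add: u_def)
  qed
  have ne: "cos (pi / N) < 1"
    using N cos_monotone_0_pi[of 0 "pi / N"] by (simp add: field_simps)
  let ?S = "\<lambda>f. \<Sum>l = - int N + 1..int N. f l :: real"
  \<comment> \<open>Summing the eigenvalue relation shows that the mean is multiplied by
    \<open>cos (pi / N) < 1\<close> without changing, so it vanishes.\<close>
  have "?S (\<lambda>l. u (l + 1)) + ?S (\<lambda>l. u (l + -1)) = 2 * cos (pi / N) * ?S u"
    using eig by (simp add: sum.distrib[symmetric] sum_distrib_left)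
  then have "2 * ?S u = 2 * cos (pi / N) * ?S u"
    by (simp only: sum_period_shift[of u, OF per])
  then have "?S u = 0" using ne by simp
  with per show "u \<in> displacements N" by (simp add: displacements_def)
  have "u 0 = 1" by (simp add: u_def)
  then show "u \<noteq> (\<lambda>_. 0)" by (metis zero_neq_one)
  have "cos (pi / N) = 1 - 2 * (sin (pi / (2 * real N)))\<^sup>2"
    using cos_double_sin[of "pi / (2 * real N)"] by simp
  with eig show "u (l + 1) + u (l - 1) = 2 * (1 - 2 * (sin (pi / (2 * real N)))\<^sup>2) * u l" by simp
qed

section \<open>The stability criterion\<close>

theorem theorem4p1:
  fixes N :: nat and F :: real and \<phi> \<rho> G :: "real \<Rightarrow> real"
  assumes "N \<ge> 1" and "F > 0"
    and "smooth_real_on \<phi> {0<..}" and "smooth_real_on \<rho> {0<..}" and "smooth_real_on G UNIV"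
    and "deriv (deriv \<phi>) F > 0" and "deriv (deriv \<phi>) (2 * F) < 0"
    and "deriv \<rho> F \<le> 0" and "deriv \<rho> (2 * F) \<le> 0"
    and "deriv (deriv \<rho>) F \<ge> 0" and "deriv (deriv \<rho>) (2 * F) \<ge> 0"
    and "deriv (deriv G) (rho_bar \<rho> F) \<ge> 0"
    and "deriv (deriv \<phi>) (2 * F)
         + deriv (deriv G) (rho_bar \<rho> F)
           * ((deriv \<rho> F)\<^sup>2 + 20 * (deriv \<rho> (2 * F))\<^sup>2 + 12 * deriv \<rho> F * deriv \<rho> (2 * F))
         + 2 * deriv G (rho_bar \<rho> F) * deriv (deriv \<rho>) (2 * F) \<le> 0"
  shows "stable_deformation N (energy_a N \<phi> \<rho> G) (uniform_deformation N F) \<longleftrightarrow>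
    A_hat G \<rho> F + A_tilde \<phi> F
    - 4 * (sin (pi / (2 * real N)))\<^sup>2
      * (deriv (deriv \<phi>) (2 * F)
         + deriv (deriv G) (rho_bar \<rho> F)
           * ((deriv \<rho> F)\<^sup>2 + 20 * (deriv \<rho> (2 * F))\<^sup>2 + 12 * deriv \<rho> F * deriv \<rho> (2 * F))
         + 2 * deriv G (rho_bar \<rho> F) * deriv (deriv \<rho>) (2 * F))
    + 4 ^ 2 * sin (pi / (2 * real N)) ^ 4 * deriv (deriv G) (rho_bar \<rho> F)
      * (8 * (deriv \<rho> (2 * F))\<^sup>2 + 2 * deriv \<rho> F * deriv \<rho> (2 * F))
    - 4 ^ 3 * sin (pi / (2 * real N)) ^ 6 * deriv (deriv G) (rho_bar \<rho> F) * (deriv \<rho> (2 * F))\<^sup>2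
    > 0"
proof -
  define a b g where "a = deriv \<rho> F" and "b = deriv \<rho> (2 * F)"
    and "g = deriv (deriv G) (rho_bar \<rho> F)"
  define P where "P = deriv (deriv \<phi>) F + 2 * deriv G (rho_bar \<rho> F) * deriv (deriv \<rho>) F"
  define Q where "Q = deriv (deriv \<phi>) (2 * F) + 2 * deriv G (rho_bar \<rho> F) * deriv (deriv \<rho>) (2 * F)"
  define s where "s = (sin (pi / (2 * real N)))\<^sup>2"
  let ?h = "dispersion a b g P Q s"
  have sv: "second_variation (energy_a N \<phi> \<rho> G) (uniform_deformation N F) u u
      = eps N * strain_form N a b g P Q (strain N u)" if "u \<in> displacements N" for u
    unfolding a_def b_def g_def P_def Q_def
    using that by (intro second_variation_eq_strain_form assms) (auto simp: displacements_def)
  have eps: "eps N > 0" using \<open>N \<ge> 1\<close> by (simp add: eps_def)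
  have K: "Q + g * (a\<^sup>2 + 20 * b\<^sup>2 + 12 * a * b) \<le> 0"
    using assms(13) by (simp add: a_def b_def g_def Q_def algebra_simps)
  \<comment> \<open>Stability amounts to positivity of the symbol at the lowest admissible
    frequency: the cosine mode gives necessity, the lower bound on the form gives
    sufficiency.\<close>
  have "stable_deformation N (energy_a N \<phi> \<rho> G) (uniform_deformation N F) \<longleftrightarrow> ?h > 0"
  proof
    assume stable: "stable_deformation N (energy_a N \<phi> \<rho> G) (uniform_deformation N F)"
    define u where "u = (\<lambda>l::int. cos (pi / N * of_int l))"
    note u = cos_displacement[OF \<open>N \<ge> 1\<close> u_def, folded s_def]
    define w where "w = strain N u"
    have perw: "w (l + 2 * int N) = w l" for l
      unfolding w_def using u(1) by (intro strain_periodic) (auto simp: displacements_def)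
    have "w (l + 1) + w (l - 1) = 2 * (1 - 2 * s) * w l" for l
    proof -
      \<comment> \<open>Differences commute with shifts, so the strain inherits the eigenvalue
        relation of \<open>u\<close>. The terms are grouped so that this relation applies at
        \<open>l\<close> and at \<open>l - 1\<close>.\<close>
      have "w (l + 1) + w (l - 1)
          = ((u (l + 1) + u (l - 1)) - (u (l - 1 + 1) + u (l - 1 - 1))) / eps N"
        by (simp add: w_def strain_def add_divide_distrib diff_divide_distrib)
      also have "\<dots> = 2 * (1 - 2 * s) * w l"
        unfolding u(3) by (simp add: w_def strain_def flip: right_diff_distrib)
      finally show ?thesis .
    qed
    from strain_form_eigen[of w, OF perw this]
    have "strain_form N a b g P Q w = ?h * (\<Sum>l = - int N + 1..int N. (w l)\<^sup>2)" .
    moreover have "eps N * strain_form N a b g P Q w > 0"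
      using stable u(1,2) unfolding stable_deformation_def w_def sv[OF u(1), symmetric] by blast
    ultimately have "?h * (\<Sum>l = - int N + 1..int N. (w l)\<^sup>2) > 0"
      using eps by (simp add: zero_less_mult_iff)
    moreover have "(\<Sum>l = - int N + 1..int N. (w l)\<^sup>2) \<ge> 0" by (simp add: sum_nonneg)
    ultimately show "?h > 0" by (auto simp: zero_less_mult_iff)
  next
    assume h: "?h > 0"
    show "stable_deformation N (energy_a N \<phi> \<rho> G) (uniform_deformation N F)"
      unfolding stable_deformation_def
    proof
      fix u assume "u \<in> displacements N - {\<lambda>_. 0}"
      then have u: "u \<in> displacements N" "u \<noteq> (\<lambda>_. 0)" by auto
      have "0 < ?h * (\<Sum>l = - int N + 1..int N. (strain N u l)\<^sup>2)"
        using h displacements_strain_sq_pos[OF \<open>N \<ge> 1\<close> u] by simp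
      also have "\<dots> \<le> strain_form N a b g P Q (strain N u)"
        unfolding s_def
      proof (rule strain_form_ge[OF \<open>N \<ge> 1\<close> _ displacements_strain_mean[OF u(1)] _ _ _ K])
        show "strain N u (l + 2 * int N) = strain N u l" for l
          using u(1) by (intro strain_periodic) (auto simp: displacements_def)
      qed (use assms in \<open>simp_all add: a_def b_def g_def\<close>)
      finally show "second_variation (energy_a N \<phi> \<rho> G) (uniform_deformation N F) u u > 0"
        using sv[OF u(1)] eps by simp
    qed
  qed
  \<comment> \<open>Expansion of the symbol in powers of \<open>s\<close>; its value at
    \<open>s = 0\<close>, namely \<open>4 * g * (a + 2 * b)^2 + P + 4 * Q\<close>, is the sum of
    \<open>A_hat\<close> and \<open>A_tilde\<close>.\<close>
  also have "?h = A_hat G \<rho> F + A_tilde \<phi> F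
    - 4 * s * (deriv (deriv \<phi>) (2 * F) + g * (a\<^sup>2 + 20 * b\<^sup>2 + 12 * a * b)
         + 2 * deriv G (rho_bar \<rho> F) * deriv (deriv \<rho>) (2 * F))
    + 4 ^ 2 * s ^ 2 * g * (8 * b\<^sup>2 + 2 * a * b) - 4 ^ 3 * s ^ 3 * g * b\<^sup>2"
    unfolding dispersion_def A_hat_def A_tilde_def P_def Q_def
      a_def[symmetric] b_def[symmetric] g_def[symmetric]
    by algebra
  finally show ?thesis
    by (simp add: s_def a_def b_def g_def flip: power_mult)
qed

end
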